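(* Let $Q_+$ be an affine semigroup with $Q=\mathbb{Z}Q_+\cong\mathbb{Z}^d$ and $R=\Bbbk[Q_+]$. For a constructible family $\{M_n\}_{n\in\mathbb{Z}^k}$ of $Q$-modules, a monomial prime ideal $\mathfrak p\subseteq R$, and a linear function $\lambda:Q\to\mathbb{Z}$, the $v$-invariants $v_{\mathfrak p}(\lambda,M_n)$ in direction $\lambda$ are piecewise quasilinear as functions of $n$ (on the set of $n$ where they are defined).
   Context: $\Bbbk$ is a field; an affine semigroup is a finitely generated submonoid with trivial units of a free abelian group; $Q$ is ordered by $q\preceq q'$ iff $q'-q\in Q_+$. Semisimple subset: finite disjoint union of sets $q+N$ with $N$ generated by linearly independent elements. A Presburger group is a partially ordered free abelian group of finite rank whose positive cone is semisimple and generates a finite-index subgroup. A module over a Presburger group $G$ is constructible if its graded pieces are finite-dimensional and $G$ can be partitioned into finitely many semisimple regions $I$ with vector spaces $M_I$ and isomorphisms $M_I\to M_g$ ($g\in I$) such that for $g\in I$, $h\in J$, $g\preceq h$, the composite $M_I\to M_g\to M_h\to M_J$ depends only on $I,J$. A family $\{M_n\}_{n\in\mathbb{Z}^k}$ of $Q$-modules is constructible if for some Presburger group $G=\mathbb{Z}^k\times Q$ with positive cone $G_+$ satisfying $G_+\cap(\{0\}\times Q)=\{0\}\times Q_+$, the direct sum $\bigoplus_nM_n(-n)$ (with $M_n$ in slice $\{n\}\times Q$) is a $G$-graded $\Bbbk[G_+]$-module extending the slice structures and is constructible. For a $Q$-module $M$, the $v$-invariant of $M$ at $\mathfrak p$ in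 direction $\lambda$ is $v_{\mathfrak p}(\lambda,M)=\min\{\langle\lambda,u\rangle\mid \mathfrak p=0:_Rf\text{ for some }f\in M_u\}$. Piecewise quasilinear: there are finitely many rational convex polyhedra covering $\mathbb{Z}^k$ on each of which the function agrees with a function that is affine-linear on each coset of some finite-index sublattice. *)

theory Defs
  imports "HOL-Analysis.Analysis" "HOL-Library.Poly_Mapping"
begin

section \<open>Lattice-theoretic preliminaries\<close>

text \<open>Nonnegative integer combinations of a finite set B (the monoid generated by B),
  with respect to an integer scalar multiplication smul.\<close>
definition ncomb :: "(int \<Rightarrow> 'g::comm_monoid_add \<Rightarrow> 'g) \<Rightarrow> 'g set \<Rightarrow> 'g set" where
  "ncomb smul B = {(\<Sum>b\<in>B. smul (int (c b)) b) | c. True}"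

text \<open>Linear independence over the integers.\<close>
definition z_lin_indep :: "(int \<Rightarrow> 'g::comm_monoid_add \<Rightarrow> 'g) \<Rightarrow> 'g set \<Rightarrow> bool" where
  "z_lin_indep smul B \<longleftrightarrow> (\<forall>c. (\<Sum>b\<in>B. smul (c b) b) = 0 \<longrightarrow> (\<forall>b\<in>B. c b = 0))"

text \<open>Semisimple subset: finite disjoint union of translates q + N, N generated by a finite
  linearly independent set.\<close>
definition semisimple :: "(int \<Rightarrow> 'g::ab_group_add \<Rightarrow> 'g) \<Rightarrow> 'g set \<Rightarrow> bool" where
  "semisimple smul S \<longleftrightarrow>
     (\<exists>F :: ('g \<times> 'g set) set. finite F \<and>
        (\<forall>(q, B)\<in>F. finite B \<and> z_lin_indep smul B) \<and>
        (\<forall>(q, B)\<in>F. \<forall>(q', B')\<in>F. (q, B) \<noteq> (q', B') \<longrightarrow>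
            ((+) q ` ncomb smul B) \<inter> ((+) q' ` ncomb smul B') = {}) \<and>
        S = (\<Union>(q, B)\<in>F. (+) q ` ncomb smul B))"

text \<open>Subgroup generated by a submonoid, and finite index.\<close>
definition group_of_monoid :: "'g::ab_group_add set \<Rightarrow> 'g set" where
  "group_of_monoid C = {a - b | a b. a \<in> C \<and> b \<in> C}"

definition finite_index :: "'g::ab_group_add set \<Rightarrow> bool" where
  "finite_index H \<longleftrightarrow> finite {(+) x ` H | x. True}"

definition is_subgroup :: "'g::ab_group_add set \<Rightarrow> bool" where
  "is_subgroup H \<longleftrightarrow> 0 \<in> H \<and> (\<forall>x\<in>H. \<forall>y\<in>H. x - y \<in> H)"

text \<open>Affine semigroup in Q = Z^d, with Z Q_+ = Q.\<close>
definition affine_semigroup :: "(int ^ 'd) set \<Rightarrow> bool" where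
  "affine_semigroup Qp \<longleftrightarrow>
     (\<exists>B. finite B \<and> Qp = ncomb (*s) B) \<and>
     (\<forall>x\<in>Qp. - x \<in> Qp \<longrightarrow> x = 0)"

text \<open>Presburger group structure on G: given by its positive cone.\<close>
definition presburger_cone :: "(int \<Rightarrow> 'g::ab_group_add \<Rightarrow> 'g) \<Rightarrow> 'g set \<Rightarrow> bool" where
  "presburger_cone smul C \<longleftrightarrow>
     0 \<in> C \<and> (\<forall>x\<in>C. \<forall>y\<in>C. x + y \<in> C) \<and> (\<forall>x\<in>C. - x \<in> C \<longrightarrow> x = 0) \<and>
     semisimple smul C \<and> finite_index (group_of_monoid C)"

section \<open>Graded modules\<close>

text \<open>A G-graded k[C]-module, C the positive cone of the grading group. Graded pieces are
  subspaces Mg g of an ambient k-vector space (sc); act c g is multiplication by the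
  monomial t^c, a map Mg g \<rightarrow> Mg (g + c).\<close>
definition graded_module ::
  "('F::field \<Rightarrow> 'v::ab_group_add \<Rightarrow> 'v) \<Rightarrow> 'g::ab_group_add set \<Rightarrow> ('g \<Rightarrow> 'v set)
     \<Rightarrow> ('g \<Rightarrow> 'g \<Rightarrow> 'v \<Rightarrow> 'v) \<Rightarrow> bool" where
  "graded_module sc C Mg act \<longleftrightarrow>
     (\<forall>g. module.subspace sc (Mg g)) \<and>
     (\<forall>c\<in>C. \<forall>g. \<forall>x\<in>Mg g. act c g x \<in> Mg (g + c)) \<and>
     (\<forall>c\<in>C. \<forall>g. \<forall>x\<in>Mg g. \<forall>y\<in>Mg g. act c g (x + y) = act c g x + act c g y) \<and>
     (\<forall>c\<in>C. \<forall>g. \<forall>a. \<forall>x\<in>Mg g. act c g (sc a x) = sc a (act c g x)) \<and>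
     (\<forall>g. \<forall>x\<in>Mg g. act 0 g x = x) \<and>
     (\<forall>c\<in>C. \<forall>c'\<in>C. \<forall>g. \<forall>x\<in>Mg g. act (c + c') g x = act c' (g + c) (act c g x))"

definition fin_dim :: "('F::field \<Rightarrow> 'v::ab_group_add \<Rightarrow> 'v) \<Rightarrow> 'v set \<Rightarrow> bool" where
  "fin_dim sc S \<longleftrightarrow> (\<exists>B. finite B \<and> B \<subseteq> S \<and> S \<subseteq> module.span sc B)"

definition lin_iso ::
  "('F::field \<Rightarrow> 'v::ab_group_add \<Rightarrow> 'v) \<Rightarrow> ('v \<Rightarrow> 'v) \<Rightarrow> 'v set \<Rightarrow> 'v set \<Rightarrow> bool" where
  "lin_iso sc f A B \<longleftrightarrow> bij_betw f A B \<and>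
     (\<forall>x\<in>A. \<forall>y\<in>A. f (x + y) = f x + f y) \<and> (\<forall>a. \<forall>x\<in>A. f (sc a x) = sc a (f x))"

text \<open>Constructible module over a Presburger group with cone C. The vector spaces M_I are
  taken to be subspaces of the ambient space (no loss: M_I is isomorphic to some M_g).\<close>
definition constructible_module ::
  "('F::field \<Rightarrow> 'v::ab_group_add \<Rightarrow> 'v) \<Rightarrow> (int \<Rightarrow> 'g::ab_group_add \<Rightarrow> 'g) \<Rightarrow> 'g set
     \<Rightarrow> ('g \<Rightarrow> 'v set) \<Rightarrow> ('g \<Rightarrow> 'g \<Rightarrow> 'v \<Rightarrow> 'v) \<Rightarrow> bool" where
  "constructible_module sc smul C Mg act \<longleftrightarrow>
     (\<forall>g. fin_dim sc (Mg g)) \<and>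
     (\<exists>(P :: 'g set set) (MI :: 'g set \<Rightarrow> 'v set) (\<phi> :: 'g set \<Rightarrow> 'g \<Rightarrow> 'v \<Rightarrow> 'v).
        finite P \<and> \<Union>P = UNIV \<and>
        (\<forall>I\<in>P. \<forall>J\<in>P. I \<noteq> J \<longrightarrow> I \<inter> J = {}) \<and>
        (\<forall>I\<in>P. semisimple smul I) \<and>
        (\<forall>I\<in>P. module.subspace sc (MI I)) \<and>
        (\<forall>I\<in>P. \<forall>g\<in>I. lin_iso sc (\<phi> I g) (MI I) (Mg g)) \<and>
        (\<forall>I\<in>P. \<forall>J\<in>P. \<exists>T. \<forall>g\<in>I. \<forall>h\<in>J. h - g \<in> C \<longrightarrow>
            (\<forall>x\<in>MI I. the_inv_into (MI J) (\<phi> J h) (act (h - g) g (\<phi> I g x)) = T x)))"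

text \<open>Integer scalar multiplication on G = Z^k \<times> Q.\<close>
definition gsmul :: "int \<Rightarrow> ((int ^ 'k) \<times> (int ^ 'd)) \<Rightarrow> ((int ^ 'k) \<times> (int ^ 'd))" where
  "gsmul c x = (c *s fst x, c *s snd x)"

text \<open>Constructible family {M_n} of Q-modules (Q = Z^d, Q_+ = Qp); M n q is the degree-q
  piece of M_n and act n a q is multiplication by t^a on it.\<close>
definition constructible_family ::
  "('F::field \<Rightarrow> 'v::ab_group_add \<Rightarrow> 'v) \<Rightarrow> (int ^ 'd) set
     \<Rightarrow> (int ^ 'k \<Rightarrow> int ^ 'd \<Rightarrow> 'v set) \<Rightarrow> (int ^ 'k \<Rightarrow> int ^ 'd \<Rightarrow> int ^ 'd \<Rightarrow> 'v \<Rightarrow> 'v) \<Rightarrow> bool" where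
  "constructible_family sc Qp M act \<longleftrightarrow>
     (\<exists>(C :: ((int ^ 'k) \<times> (int ^ 'd)) set) actN.
        presburger_cone gsmul C \<and>
        C \<inter> {x. fst x = 0} = {(0, a) | a. a \<in> Qp} \<and>
        graded_module sc C (\<lambda>(n, q). M n q) actN \<and>
        (\<forall>n q. \<forall>a\<in>Qp. \<forall>x\<in>M n q. actN (0, a) (n, q) x = act n a q x) \<and>
        constructible_module sc gsmul C (\<lambda>(n, q). M n q) actN)"

section \<open>The semigroup ring R = k[Q_+] and its ideals\<close>

definition sgring :: "(int ^ 'd) set \<Rightarrow> ((int ^ 'd) \<Rightarrow>\<^sub>0 'F::field) set" where
  "sgring Qp = {r. Poly_Mapping.keys r \<subseteq> Qp}"

definition is_ideal_in :: "'r::comm_ring_1 set \<Rightarrow> 'r set \<Rightarrow> bool" where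
  "is_ideal_in R I \<longleftrightarrow> I \<subseteq> R \<and> 0 \<in> I \<and> (\<forall>x\<in>I. \<forall>y\<in>I. x - y \<in> I) \<and>
     (\<forall>r\<in>R. \<forall>x\<in>I. r * x \<in> I)"

definition prime_ideal_in :: "'r::comm_ring_1 set \<Rightarrow> 'r set \<Rightarrow> bool" where
  "prime_ideal_in R I \<longleftrightarrow> is_ideal_in R I \<and> I \<noteq> R \<and>
     (\<forall>a\<in>R. \<forall>b\<in>R. a * b \<in> I \<longrightarrow> a \<in> I \<or> b \<in> I)"

definition ideal_gen_in :: "'r::comm_ring_1 set \<Rightarrow> 'r set \<Rightarrow> 'r set" where
  "ideal_gen_in R S = \<Inter>{I. is_ideal_in R I \<and> S \<subseteq> I}"

text \<open>Monomial ideal: generated by the monomials it contains.\<close>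
definition monomial_ideal :: "(int ^ 'd) set \<Rightarrow> ((int ^ 'd) \<Rightarrow>\<^sub>0 'F::field) set \<Rightarrow> bool" where
  "monomial_ideal Qp I \<longleftrightarrow> is_ideal_in (sgring Qp) I \<and>
     I = ideal_gen_in (sgring Qp) {Poly_Mapping.single a 1 | a. a \<in> Qp \<and> Poly_Mapping.single a 1 \<in> I}"

text \<open>Annihilator 0 :_R f of a homogeneous element f of degree u of the Q-module (Mg, act):
  r f has degree-(u+a) component  r_a t^a f, so r f = 0 iff all these components vanish.\<close>
definition annihilator ::
  "('F::field \<Rightarrow> 'v::ab_group_add \<Rightarrow> 'v) \<Rightarrow> (int ^ 'd) set \<Rightarrow> (int ^ 'd \<Rightarrow> int ^ 'd \<Rightarrow> 'v \<Rightarrow> 'v)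
     \<Rightarrow> int ^ 'd \<Rightarrow> 'v \<Rightarrow> ((int ^ 'd) \<Rightarrow>\<^sub>0 'F) set" where
  "annihilator sc Qp act u f =
     {r \<in> sgring Qp. \<forall>a. sc (Poly_Mapping.lookup r a) (act a u f) = 0}"

section \<open>v-invariants\<close>

definition vset ::
  "('F::field \<Rightarrow> 'v::ab_group_add \<Rightarrow> 'v) \<Rightarrow> (int ^ 'd) set \<Rightarrow> (int ^ 'd \<Rightarrow> 'v set)
     \<Rightarrow> (int ^ 'd \<Rightarrow> int ^ 'd \<Rightarrow> 'v \<Rightarrow> 'v) \<Rightarrow> ((int ^ 'd) \<Rightarrow>\<^sub>0 'F) set \<Rightarrow> (int ^ 'd \<Rightarrow> int)
     \<Rightarrow> int set" where
  "vset sc Qp Mg act p lam =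
     {lam u | u f. f \<in> Mg u \<and> p = annihilator sc Qp act u f}"

text \<open>v_p(lam, M) is defined iff the minimum exists; its value is then the least element.\<close>
definition v_defined ::
  "('F::field \<Rightarrow> 'v::ab_group_add \<Rightarrow> 'v) \<Rightarrow> (int ^ 'd) set \<Rightarrow> (int ^ 'd \<Rightarrow> 'v set)
     \<Rightarrow> (int ^ 'd \<Rightarrow> int ^ 'd \<Rightarrow> 'v \<Rightarrow> 'v) \<Rightarrow> ((int ^ 'd) \<Rightarrow>\<^sub>0 'F) set \<Rightarrow> (int ^ 'd \<Rightarrow> int) \<Rightarrow> bool" where
  "v_defined sc Qp Mg act p lam \<longleftrightarrow>
     (\<exists>m\<in>vset sc Qp Mg act p lam. \<forall>x\<in>vset sc Qp Mg act p lam. m \<le> x)"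

definition v_inv ::
  "('F::field \<Rightarrow> 'v::ab_group_add \<Rightarrow> 'v) \<Rightarrow> (int ^ 'd) set \<Rightarrow> (int ^ 'd \<Rightarrow> 'v set)
     \<Rightarrow> (int ^ 'd \<Rightarrow> int ^ 'd \<Rightarrow> 'v \<Rightarrow> 'v) \<Rightarrow> ((int ^ 'd) \<Rightarrow>\<^sub>0 'F) set \<Rightarrow> (int ^ 'd \<Rightarrow> int) \<Rightarrow> int" where
  "v_inv sc Qp Mg act p lam = (LEAST x. x \<in> vset sc Qp Mg act p lam)"

section \<open>Piecewise quasilinear functions\<close>

definition rdot :: "rat ^ 'k \<Rightarrow> int ^ 'k \<Rightarrow> rat" where
  "rdot a n = (\<Sum>i\<in>UNIV. a $ i * of_int (n $ i))"

definition rat_polyhedron :: "(int ^ 'k) set \<Rightarrow> bool" where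
  "rat_polyhedron P \<longleftrightarrow> (\<exists>H :: ((rat ^ 'k) \<times> rat) set. finite H \<and>
     P = {n. \<forall>(a, b)\<in>H. rdot a n \<le> b})"

text \<open>Piecewise quasilinear on the domain D: finitely many rational convex polyhedra covering
  Z^k, on each of which f agrees (on D) with a function that is affine-linear on each coset
  of some finite-index sublattice L.\<close>
definition piecewise_quasilinear_on :: "(int ^ 'k) set \<Rightarrow> (int ^ 'k \<Rightarrow> int) \<Rightarrow> bool" where
  "piecewise_quasilinear_on D f \<longleftrightarrow>
     (\<exists>\<P>. finite \<P> \<and> (\<forall>P\<in>\<P>. rat_polyhedron P) \<and> \<Union>\<P> = UNIV \<and>
        (\<forall>P\<in>\<P>. \<exists>L. is_subgroup L \<and> finite_index L \<and>
           (\<forall>c. \<exists>(a :: rat ^ 'k) (b :: rat). \<forall>n\<in>P \<inter> D. n - c \<in> L \<longrightarrow>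
               of_int (f n) = rdot a n + b)))"

end

theory Submission
  imports Defs
begin

text \<open>On a region \<open>I\<close> of a constructible family, which monomials kill an element depends only on
  the regions that the products land in. Hence the set of degrees \<open>(n, u)\<close> of elements with
  annihilator \<open>p\<close> is definable in Presburger arithmetic. By quantifier elimination so is
  the set of pairs \<open>(n, t)\<close> with \<open>t = \<lambda>(u)\<close> for such a \<open>u\<close>, and its least elements \<open>t\<close> over \<open>n\<close> must lie
  near one of the finitely many affine bounds that occur in a quantifier-free definition, that is,
  on one of finitely many affine functions of \<open>n\<close>. Which one is attained is again decided by signs and
  residues of finitely many affine functions, and these give the polyhedra and the sublattice.\<close>

section \<open>Presburger sets\<close>

text \<open>Equivalent to additivity of \<open>h - h 0\<close>. No scalars or coordinates occur, so
  the parameters in quantifier elimination may range over any abelian group.\<close>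

definition affine_hom :: "('a::ab_group_add \<Rightarrow> 'b::ab_group_add) \<Rightarrow> bool" where
  "affine_hom h \<longleftrightarrow> (\<forall>x y. h (x + y) + h 0 = h x + h y)"

lemma affine_homI: "(\<And>x y. h (x + y) + h 0 = h x + h y) \<Longrightarrow> affine_hom h"
  by (simp add: affine_hom_def)

lemma affine_homD: "affine_hom h \<Longrightarrow> h (x + y) + h 0 = h x + h y"
  by (simp add: affine_hom_def)

lemma affine_hom_comp:
  assumes "affine_hom h" "affine_hom f"
  shows "affine_hom (\<lambda>x. h (f x))"
proof (rule affine_homI)
  fix x y
  have "h (f (x + y)) + h (f 0) = h (f (x + y) + f 0) + h 0"
    using affine_homD[OF assms(1)] by metis
  also have "\<dots> = h (f x + f y) + h 0" using affine_homD[OF assms(2)] by metis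
  also have "\<dots> = h (f x) + h (f y)" using affine_homD[OF assms(1)] by metis
  finally show "h (f (x + y)) + h (f 0) = h (f x) + h (f y)" .
qed

lemma affine_hom_const: "affine_hom (\<lambda>_. c)"
  by (simp add: affine_hom_def)

lemma affine_hom_add:
  assumes "affine_hom f" "affine_hom g"
  shows "affine_hom (\<lambda>x. f x + g x)"
proof (rule affine_homI)
  fix x y
  have "f (x + y) + g (x + y) + (f 0 + g 0) = (f (x + y) + f 0) + (g (x + y) + g 0)"
    by (simp add: ac_simps)
  also have "\<dots> = (f x + f y) + (g x + g y)"
    using affine_homD[OF assms(1)] affine_homD[OF assms(2)] by metis
  finally show "f (x + y) + g (x + y) + (f 0 + g 0) = f x + g x + (f y + g y)"
    by (simp add: ac_simps)
qed

lemma affine_hom_diff: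
  assumes "affine_hom f" "affine_hom g"
  shows "affine_hom (\<lambda>x. f x - g x)"
proof (rule affine_homI)
  fix x y
  have "f (x + y) - g (x + y) + (f 0 - g 0) = (f (x + y) + f 0) - (g (x + y) + g 0)"
    by simp
  also have "\<dots> = (f x + f y) - (g x + g y)"
    using affine_homD[OF assms(1)] affine_homD[OF assms(2)] by metis
  finally show "f (x + y) - g (x + y) + (f 0 - g 0) = f x - g x + (f y - g y)"
    by simp
qed

lemma affine_hom_mult:
  fixes f :: "'a::ab_group_add \<Rightarrow> int"
  assumes "affine_hom f"
  shows "affine_hom (\<lambda>x. c * f x)"
  using affine_homD[OF assms] by (intro affine_homI) (simp flip: distrib_left)

lemma affine_hom_Pair:
  assumes "affine_hom f" "affine_hom g"
  shows "affine_hom (\<lambda>x. (f x, g x))"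
  using assms by (simp add: affine_hom_def)

lemma affine_hom_id: "affine_hom (\<lambda>x. x)"
  by (simp add: affine_hom_def)

lemma affine_hom_fst: "affine_hom fst"
  by (simp add: affine_hom_def)

lemma affine_hom_snd: "affine_hom snd"
  by (simp add: affine_hom_def)

lemma affine_hom_nth: "affine_hom (\<lambda>x :: int ^ 'n. x $ i)"
  by (simp add: affine_hom_def)

lemma affine_hom_additive:
  assumes "\<And>x y. h (x + y) = h x + h y"
  shows "affine_hom h"
  using assms assms[of 0 0] by (simp add: affine_hom_def)

lemma affine_hom_int_line:
  fixes h :: "int \<Rightarrow> int"
  assumes "affine_hom h"
  shows "h t = h 0 + (h 1 - h 0) * t"
proof (induction t rule: int_induct[where k = 0])
  case (step1 i)
  then show ?case using affine_homD[OF assms, of i 1] by (simp add: algebra_simps)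
next
  case (step2 i)
  then show ?case using affine_homD[OF assms, of "i - 1" 1] by (simp add: algebra_simps)
qed simp

text \<open>Splits off the variable to be eliminated: its coefficient is the same for all
  \<open>x\<close>.\<close>

lemma affine_hom_prod_int:
  fixes h :: "'a::ab_group_add \<times> int \<Rightarrow> int"
  assumes "affine_hom h"
  shows "h (x, t) = h (x, 0) + (h (0, 1) - h (0, 0)) * t"
proof -
  have "affine_hom (\<lambda>t. h (0, t))"
    by (rule affine_hom_comp[OF assms affine_hom_Pair[OF affine_hom_const affine_hom_id]])
  from affine_hom_int_line[OF this, of t] show ?thesis
    using affine_homD[OF assms, of "(x, 0)" "(0, t)"] by (simp add: zero_prod_def)
qed

text \<open>Two signs suffice: a zero of \<open>h\<close> is detected by having both
  \<open>h\<close> and \<open>- h\<close> among the functions.\<close>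

definition same_type :: "('a \<Rightarrow> int) set \<Rightarrow> int \<Rightarrow> 'a \<Rightarrow> 'a \<Rightarrow> bool" where
  "same_type H m x y \<longleftrightarrow> (\<forall>h\<in>H. (h x \<le> 0 \<longleftrightarrow> h y \<le> 0) \<and> m dvd h x - h y)"

text \<open>One implication is enough because \<open>same_type\<close> is symmetric.\<close>

definition decided_by :: "('a \<Rightarrow> int) set \<Rightarrow> int \<Rightarrow> 'a set \<Rightarrow> bool" where
  "decided_by H m S \<longleftrightarrow> (\<forall>x y. same_type H m x y \<longrightarrow> x \<in> S \<longrightarrow> y \<in> S)"

text \<open>A quantifier-free form of definability in Presburger arithmetic: membership depends only on
  the signs and the residues of finitely many affine functions.\<close>
definition presburger_set :: "'a::ab_group_add set \<Rightarrow> bool" where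
  "presburger_set S \<longleftrightarrow>
     (\<exists>H m. finite H \<and> (\<forall>h\<in>H. affine_hom h) \<and> m > 0 \<and> decided_by H m S)"

lemma presburger_setI:
  assumes "finite H" "\<forall>h\<in>H. affine_hom h" "m > 0" "decided_by H m S"
  shows "presburger_set S"
  unfolding presburger_set_def using assms by (intro exI conjI)

lemma presburger_setE:
  assumes "presburger_set S"
  obtains H m where "finite H" "\<forall>h\<in>H. affine_hom h" "m > 0" "decided_by H m S"
  using assms unfolding presburger_set_def by (elim exE conjE)

section \<open>Closure properties of Presburger sets\<close>

lemma same_type_sym: "same_type H m x y \<Longrightarrow> same_type H m y x"
  unfolding same_type_def by (metis dvd_diff_commute)

lemma same_type_trans: "same_type H m x y \<Longrightarrow> same_type H m y z \<Longrightarrow> same_type H m x z"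
  unfolding same_type_def using dvd_add[of m "h x - h y" "h y - h z" for h] by simp

lemma decided_by_mono:
  assumes "decided_by H m S" "H \<subseteq> H'" "m dvd m'"
  shows "decided_by H' m' S"
  using assms unfolding decided_by_def same_type_def by (meson dvd_trans subsetD)

lemma decided_by_Compl: "decided_by H m S \<Longrightarrow> decided_by H m (- S)"
  unfolding decided_by_def using same_type_sym by fastforce

lemma presburger_set_Compl: "presburger_set S \<Longrightarrow> presburger_set (- S)"
  unfolding presburger_set_def using decided_by_Compl by blast

text \<open>Unite the sets of functions and multiply the moduli: finer data decide whatever coarser
  data decide. With shared data, Boolean operations on the sets become pointwise logic.\<close>

lemma presburger_set_common:
  assumes "finite I" "\<forall>i\<in>I. presburger_set (S i)"
  shows "\<exists>H m. finite H \<and> (\<forall>h\<in>H. affine_hom h) \<and> m > 0 \<and> (\<forall>i\<in>I. decided_by H m (S i))"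
  using assms
proof (induction I rule: finite_induct)
  case empty
  show ?case by (rule exI[of _ "{}"], rule exI[of _ 1]) simp
next
  case (insert i I)
  have "\<exists>H m. finite H \<and> (\<forall>h\<in>H. affine_hom h) \<and> m > 0 \<and> (\<forall>i\<in>I. decided_by H m (S i))"
    using insert.IH insert.prems by simp
  then obtain H m where 1: "finite H" "\<forall>h\<in>H. affine_hom h" "m > 0" "\<forall>i\<in>I. decided_by H m (S i)"
    by (elim exE conjE)
  obtain H' m' where 2: "finite H'" "\<forall>h\<in>H'. affine_hom h" "m' > 0" "decided_by H' m' (S i)"
    using insert.prems by (auto elim: presburger_setE)
  have "decided_by (H \<union> H') (m * m') (S j)" if "j \<in> insert i I" for j
    using that 1(4) decided_by_mono[OF 2(4), of "H \<union> H'" "m * m'"]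
      decided_by_mono[of H m "S j" "H \<union> H'" "m * m'"] by auto
  then have "\<forall>j\<in>insert i I. decided_by (H \<union> H') (m * m') (S j)" by blast
  moreover have "finite (H \<union> H')" "\<forall>h\<in>H \<union> H'. affine_hom h" "m * m' > 0"
    using 1(1-3) 2(1-3) by auto
  ultimately show ?case by (intro exI conjI)
qed

lemma presburger_set_INT:
  assumes "finite I" "\<And>i. i \<in> I \<Longrightarrow> presburger_set (S i)"
  shows "presburger_set (\<Inter>i\<in>I. S i)"
proof -
  have "\<forall>i\<in>I. presburger_set (S i)" using assms(2) by simp
  from presburger_set_common[OF assms(1) this] obtain H m
    where H: "finite H" "\<forall>h\<in>H. affine_hom h" "m > 0" "\<forall>i\<in>I. decided_by H m (S i)"
    by (elim exE conjE)
  then have "decided_by H m (\<Inter>i\<in>I. S i)" unfolding decided_by_def by blast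
  then show ?thesis by (rule presburger_setI[OF H(1-3)])
qed

lemma presburger_set_UN:
  assumes "finite I" "\<And>i. i \<in> I \<Longrightarrow> presburger_set (S i)"
  shows "presburger_set (\<Union>i\<in>I. S i)"
proof -
  have "presburger_set (- (\<Inter>i\<in>I. - S i))"
    by (intro presburger_set_Compl presburger_set_INT assms)
  then show ?thesis by simp
qed

lemma presburger_set_Int:
  assumes "presburger_set S" "presburger_set T"
  shows "presburger_set (S \<inter> T)"
proof -
  have "presburger_set (\<Inter>b\<in>{True, False}. if b then S else T)"
    by (rule presburger_set_INT) (use assms in auto)
  then show ?thesis by (simp add: Int_commute)
qed

lemma presburger_set_Diff:
  "presburger_set S \<Longrightarrow> presburger_set T \<Longrightarrow> presburger_set (S - T)"
  by (simp add: Diff_eq presburger_set_Int presburger_set_Compl)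

lemma presburger_set_empty: "presburger_set {}"
  using presburger_set_UN[of "{}"] by simp

text \<open>Precomposing with \<open>f\<close> keeps the functions affine and carries types over
  unchanged.\<close>

lemma presburger_set_vimage:
  assumes "presburger_set S" "affine_hom f"
  shows "presburger_set {x. f x \<in> S}"
proof -
  obtain H m where H: "finite H" "\<forall>h\<in>H. affine_hom h" "m > 0" "decided_by H m S"
    using assms(1) by (elim presburger_setE)
  let ?H = "(\<lambda>h x. h (f x)) ` H"
  have "decided_by ?H m {x. f x \<in> S}"
    using H(4) unfolding decided_by_def same_type_def by simp
  moreover have "\<forall>h\<in>?H. affine_hom h"
    using H(2) affine_hom_comp[OF _ assms(2)] by blast
  moreover have "finite ?H" using H(1) by simp
  ultimately show ?thesis using presburger_setI[of ?H m] H(3) by metis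
qed

lemma presburger_set_le:
  assumes "affine_hom f" "affine_hom g"
  shows "presburger_set {x. f x \<le> (g x :: int)}"
proof -
  have "decided_by {\<lambda>x. f x - g x} 1 {x. f x \<le> g x}"
    by (simp add: decided_by_def same_type_def)
  then show ?thesis
    using affine_hom_diff[OF assms] by (intro presburger_setI[of "{\<lambda>x. f x - g x}" 1]) simp_all
qed

lemma presburger_set_eq:
  assumes "affine_hom f" "affine_hom g"
  shows "presburger_set {x. f x = (g x :: int)}"
proof -
  have "{x. f x = g x} = {x. f x \<le> g x} \<inter> {x. g x \<le> f x}" by auto
  then show ?thesis by (simp add: presburger_set_Int presburger_set_le assms)
qed

section \<open>Quantifier elimination\<close>

lemma le_mult_of_le: "(a::int) \<le> c * b" if "a \<le> b" "0 \<le> b" "1 \<le> c"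
  using mult_right_mono[OF that(3,2)] that(1) by linarith

text \<open>Descending from \<open>t\<close> in steps of \<open>m\<close>, either no sign ever changes, or one stops just before
  the first change.\<close>
lemma descend_to_threshold:
  fixes H :: "('a::ab_group_add \<times> int \<Rightarrow> int) set"
  assumes aff: "\<And>h. h \<in> H \<Longrightarrow> affine_hom h" and m: "m > 0"
  defines "c \<equiv> \<lambda>h. h (0, 1) - h (0, 0)"
  shows "(\<forall>h\<in>H. (c h > 0 \<longrightarrow> h (x, t) \<le> 0) \<and> (c h < 0 \<longrightarrow> h (x, t) > 0)) \<or>
    (\<exists>t'. same_type H m (x, t) (x, t') \<and> \<not> same_type H m (x, t') (x, t' - m))"
proof (cases "\<forall>j. same_type H m (x, t) (x, t - int j * m)")
  case True
  have "(c h > 0 \<longrightarrow> h (x, t) \<le> 0) \<and> (c h < 0 \<longrightarrow> h (x, t) > 0)" if h: "h \<in> H" for h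
  proof -
    \<comment> \<open>After this many steps \<open>h\<close> has moved by more than \<bar>h (x,
      t)\<bar>, so its sign there is forced by that of \<open>c h\<close>; as no sign changes,
      \<open>h (x, t)\<close> already has it.\<close>
    define j where "j = nat (\<bar>h (x, t)\<bar> + 1)"
    have eq: "h (x, t - int j * m) = h (x, t) - c h * (int j * m)"
      using affine_hom_prod_int[OF aff[OF h]] unfolding c_def by (smt (verit) right_diff_distrib)
    have jm: "int j * m \<ge> \<bar>h (x, t)\<bar> + 1"
      using m le_mult_of_le[of "\<bar>h (x, t)\<bar> + 1" "int j" m] unfolding j_def by (simp add: mult.commute)
    have sgn: "h (x, t) \<le> 0 \<longleftrightarrow> h (x, t - int j * m) \<le> 0"
      using True h unfolding same_type_def by blast
    have "c h > 0 \<Longrightarrow> c h * (int j * m) \<ge> \<bar>h (x, t)\<bar> + 1"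
      by (rule le_mult_of_le[OF jm]) (use jm in linarith)+
    moreover have "c h < 0 \<Longrightarrow> (- c h) * (int j * m) \<ge> \<bar>h (x, t)\<bar> + 1"
      by (rule le_mult_of_le[OF jm]) (use jm in linarith)+
    ultimately show ?thesis using eq sgn by (smt (verit) mult_minus_left)
  qed
  then show ?thesis by blast
next
  case False
  define P where "P j \<longleftrightarrow> \<not> same_type H m (x, t) (x, t - int j * m)" for j :: nat
  obtain j where j: "P j" "\<And>i. i < j \<Longrightarrow> \<not> P i"
    using False exists_least_iff[of P] unfolding P_def by blast
  \<comment> \<open>The first failure is thus not at 0 and has a predecessor, which is the
    \<open>t'\<close> sought.\<close>
  have "\<not> P 0" by (simp add: P_def same_type_def)
  then obtain i where i: "j = Suc i" using j(1) by (metis not0_implies_Suc)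
  have "same_type H m (x, t) (x, t - int i * m)" using j(2)[of i] i by (simp add: P_def)
  moreover have "t - int i * m - m = t - int j * m" by (simp add: i algebra_simps)
  then have "\<not> same_type H m (x, t - int i * m) (x, t - int i * m - m)"
    using j(1) calculation same_type_trans unfolding P_def by metis
  ultimately show ?thesis by blast
qed

text \<open>A step of \<open>m\<close> preserves all residues modulo \<open>m\<close>, so a change
  of type is a change of sign, and then the value is at most as large as the jump.\<close>

lemma step_near_threshold:
  fixes H :: "('a::ab_group_add \<times> int \<Rightarrow> int) set"
  assumes aff: "\<And>h. h \<in> H \<Longrightarrow> affine_hom h" and m: "m > 0"
    and "\<not> same_type H m (x, t) (x, t - m)"
  obtains h where "h \<in> H" "h (0, 1) - h (0, 0) \<noteq> 0" "\<bar>h (x, t)\<bar> \<le> \<bar>h (0, 1) - h (0, 0)\<bar> * m"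
proof -
  obtain h where h: "h \<in> H" "\<not> ((h (x, t) \<le> 0 \<longleftrightarrow> h (x, t - m) \<le> 0) \<and> m dvd h (x, t) - h (x, t - m))"
    using assms(3) unfolding same_type_def by blast
  define c where "c = h (0, 1) - h (0, 0)"
  have eq: "h (x, t - m) = h (x, t) - c * m"
    using affine_hom_prod_int[OF aff[OF h(1)]] unfolding c_def by (smt (verit) right_diff_distrib)
  then have flip: "\<not> (h (x, t) \<le> 0 \<longleftrightarrow> h (x, t) - c * m \<le> 0)" using h(2) by simp
  then have "c \<noteq> 0" by auto
  moreover have "\<bar>h (x, t)\<bar> \<le> \<bar>c * m\<bar>" using flip by linarith
  ultimately show ?thesis using that h(1) m unfolding c_def by (simp add: abs_mult)
qed

text \<open>Elimination of one integer variable in the style of Cooper. A witness over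
  \<open>x\<close> either can descend forever without a change of sign or can be moved near a
  threshold. In both cases a witness of the same type over \<open>y\<close> is built.\<close>

theorem presburger_set_fst_image:
  fixes S :: "('a::ab_group_add \<times> int) set"
  assumes "presburger_set S"
  shows "presburger_set (fst ` S)"
proof -
  obtain H m where fin: "finite H" and "\<forall>h\<in>H. affine_hom h" and m: "m > 0"
    and dec: "decided_by H m S"
    using assms by (elim presburger_setE)
  then have aff: "\<And>h. h \<in> H \<Longrightarrow> affine_hom h" by simp
  define c where "c h = h (0, 1) - h (0, 0)" for h :: "'a \<times> int \<Rightarrow> int"
  define g where "g h x = h (x, 0)" for h :: "'a \<times> int \<Rightarrow> int" and x
  have form: "h (x, t) = g h x + c h * t" if "h \<in> H" for h x t
    using affine_hom_prod_int[OF aff[OF that]] unfolding c_def g_def by blast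
  \<comment> \<open>A uniform bound on values near a threshold, so that only finitely many values
    \<open>r\<close> need to be considered.\<close>
  define N where "N = (\<Sum>h\<in>H. \<bar>c h\<bar> * m)"
  have N: "\<bar>c h\<bar> * m \<le> N" if "h \<in> H" for h
    unfolding N_def using member_le_sum[of h H "\<lambda>h. \<bar>c h\<bar> * m"] that fin m by simp
  define H0 where "H0 = {h \<in> H. c h \<noteq> 0}"
  \<comment> \<open>A common multiple of all \<open>c h * m\<close> with nonzero \<open>c h\<close>,
    so that the equation for a shifted witness is solvable in integers.\<close>
  define m' where "m' = m * (\<Prod>h\<in>H0. \<bar>c h\<bar>)"
  have fin0: "finite H0" using fin by (simp add: H0_def)
  have m': "m' > 0" unfolding m'_def using m by (auto intro!: mult_pos_pos prod_pos simp: H0_def)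
  have m'_dvd: "c h * m dvd m'" if "h \<in> H0" for h
    using dvd_prodI[OF fin0 that, of "\<lambda>h. \<bar>c h\<bar>"] unfolding m'_def
    by (metis abs_dvd_iff dvd_refl mult.commute mult_dvd_mono)
  text \<open>If \<open>c h * t + g h x = r\<close>, then \<open>cmp (h, h', r) x\<close> is \<open>\<bar>c h\<bar>\<close> times
    \<open>c h' * t + g h' x\<close>.\<close>
  define cmp where "cmp = (\<lambda>(h, h', r) x. sgn (c h) * (c h' * r - c h' * g h x + c h * g h' x))"
  have cmp: "(h' (x, t) \<le> 0) = (cmp (h, h', h (x, t)) x \<le> 0)" if "h \<in> H0" "h' \<in> H" for h h' x t
  proof -
    have "cmp (h, h', h (x, t)) x = (sgn (c h) * c h) * h' (x, t)"
      using that form[of h] form[of h'] unfolding cmp_def H0_def by (simp add: algebra_simps)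
    also have "sgn (c h) * c h = \<bar>c h\<bar>" by (simp add: abs_sgn mult.commute)
    finally show ?thesis using that(1) by (simp add: H0_def mult_le_0_iff)
  qed
  \<comment> \<open>The \<open>g h\<close> record all residues and the signs of functions not
    involving \<open>t\<close>; the \<open>cmp\<close> functions record all signs once one function
    takes a prescribed small value.\<close>
  define H' where "H' = g ` H \<union> cmp ` (H \<times> H \<times> {-N..N})"
  have "affine_hom (g h)" if "h \<in> H" for h
    unfolding g_def
    by (rule affine_hom_comp[OF aff[OF that] affine_hom_Pair[OF affine_hom_id affine_hom_const]])
  then have aff': "\<forall>h\<in>H'. affine_hom h"
    unfolding H'_def cmp_def
    by (auto intro!: affine_hom_add affine_hom_diff affine_hom_mult affine_hom_const)
  have "y \<in> fst ` S" if xy: "same_type H' m' x y" and "x \<in> fst ` S" for x y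
  proof -
    obtain t where t: "(x, t) \<in> S" using \<open>x \<in> fst ` S\<close> by auto
    have gxy: "m' dvd g h x - g h y" "g h x \<le> 0 \<longleftrightarrow> g h y \<le> 0" if "h \<in> H" for h
      using xy that unfolding same_type_def H'_def by auto
    have m_dvd: "m dvd g h x - g h y" if "h \<in> H" for h
      using gxy(1)[OF that] unfolding m'_def by (rule dvd_mult_left)
    consider "\<forall>h\<in>H. (c h > 0 \<longrightarrow> h (x, t) \<le> 0) \<and> (c h < 0 \<longrightarrow> h (x, t) > 0)"
      | t' where "same_type H m (x, t) (x, t')" "\<not> same_type H m (x, t') (x, t' - m)"
      using descend_to_threshold[of H m x t] aff m unfolding c_def by blast
    then obtain s t' where s: "same_type H m (x, t) (x, t')" "same_type H m (x, t') (y, s)"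
    proof cases
      case 1
      \<comment> \<open>Far enough below \<open>t\<close>, the signs over \<open>y\<close> are
        forced by the coefficients, as they are over \<open>x\<close> in this case. Moving by a
        multiple of \<open>m\<close> keeps the residues.\<close>
      define j where "j = (\<Sum>h\<in>H. \<bar>h (y, t)\<bar>) + 1"
      have j: "\<bar>h (y, t)\<bar> + 1 \<le> j" if "h \<in> H" for h
        unfolding j_def using member_le_sum[of h H "\<lambda>h. \<bar>h (y, t)\<bar>"] that fin by simp
      have "(h (x, t) \<le> 0 \<longleftrightarrow> h (y, t - j * m) \<le> 0) \<and> m dvd h (x, t) - h (y, t - j * m)"
        if h: "h \<in> H" for h
      proof
        have eq: "h (y, t - j * m) = h (y, t) - c h * (j * m)"
          using form[OF h] by (simp add: algebra_simps)
        have jm: "j * m \<ge> \<bar>h (y, t)\<bar> + 1"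
          using m j[OF h] le_mult_of_le[of "\<bar>h (y, t)\<bar> + 1" j m] by (simp add: mult.commute)
        have "c h > 0 \<Longrightarrow> c h * (j * m) \<ge> \<bar>h (y, t)\<bar> + 1"
          by (rule le_mult_of_le[OF jm]) (use jm in linarith)+
        moreover have "c h < 0 \<Longrightarrow> (- c h) * (j * m) \<ge> \<bar>h (y, t)\<bar> + 1"
          by (rule le_mult_of_le[OF jm]) (use jm in linarith)+
        moreover have "c h = 0 \<Longrightarrow> h (x, t) \<le> 0 \<longleftrightarrow> h (y, t) \<le> 0"
          using gxy(2)[OF h] form[OF h] by simp
        ultimately show "h (x, t) \<le> 0 \<longleftrightarrow> h (y, t - j * m) \<le> 0"
          using eq 1 h by (cases "c h" "0 :: int" rule: linorder_cases) (force, force, force)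
        have "h (x, t) - h (y, t - j * m) = (g h x - g h y) + c h * j * m"
          using form[OF h] by (simp add: algebra_simps)
        then show "m dvd h (x, t) - h (y, t - j * m)"
          using m_dvd[OF h] by simp
      qed
      then have "same_type H m (x, t) (y, t - j * m)" unfolding same_type_def by blast
      moreover have "same_type H m (x, t) (x, t)" by (simp add: same_type_def)
      ultimately show ?thesis using that by blast
    next
      case 2
      obtain h where h: "h \<in> H" "c h \<noteq> 0" "\<bar>h (x, t')\<bar> \<le> \<bar>c h\<bar> * m"
        using step_near_threshold[OF aff m 2(2)] unfolding c_def by blast
      then have h0: "h \<in> H0" by (simp add: H0_def)
      have r: "h (x, t') \<in> {-N..N}" using h(3) N[OF h(1)] by auto
      obtain q where q: "g h x - g h y = c h * m * q"
        using dvd_trans[OF m'_dvd[OF h0] gxy(1)[OF h(1)]] by (elim dvdE)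
      \<comment> \<open>The point over \<open>y\<close> at which \<open>h\<close> takes the same
        value as at \<open>(x, t')\<close>. It differs from \<open>t'\<close> by a multiple of
        \<open>m\<close>, so residues survive.\<close>
      define s where "s = t' + m * q"
      have hs: "h (y, s) = h (x, t')"
        using form[OF h(1)] q unfolding s_def by (simp add: algebra_simps)
      have "(h' (x, t') \<le> 0 \<longleftrightarrow> h' (y, s) \<le> 0) \<and> m dvd h' (x, t') - h' (y, s)"
        if h': "h' \<in> H" for h'
      proof
        have "cmp (h, h', h (x, t')) \<in> H'" unfolding H'_def using h(1) h' r by blast
        then have "cmp (h, h', h (x, t')) x \<le> 0 \<longleftrightarrow> cmp (h, h', h (x, t')) y \<le> 0"
          using xy unfolding same_type_def by blast
        then show "h' (x, t') \<le> 0 \<longleftrightarrow> h' (y, s) \<le> 0"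
          using cmp[OF h0 h'] hs by metis
        have "h' (x, t') - h' (y, s) = (g h' x - g h' y) - c h' * q * m"
          using form[OF h'] unfolding s_def by (simp add: algebra_simps)
        then show "m dvd h' (x, t') - h' (y, s)" using m_dvd[OF h'] by simp
      qed
      then have "same_type H m (x, t') (y, s)" unfolding same_type_def by blast
      then show ?thesis using that 2(1) by blast
    qed
    then have "(y, s) \<in> S" using dec t unfolding decided_by_def by blast
    then show ?thesis by force
  qed
  then have "decided_by H' m' (fst ` S)" unfolding decided_by_def by blast
  moreover have "finite H'" unfolding H'_def using fin by simp
  ultimately show ?thesis using presburger_setI[OF _ aff' m'] by blast
qed

lemma presburger_set_ex:
  assumes "presburger_set {(x, t :: int). P x t}"
  shows "presburger_set {x. \<exists>t. P x t}"
proof -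
  have "{x. \<exists>t. P x t} = fst ` {(x, t). P x t}" by force
  then show ?thesis using presburger_set_fst_image[OF assms] by simp
qed


lemma presburger_set_ex_vec:
  assumes "presburger_set {(x, u :: int ^ 'd). P x u}"
  shows "presburger_set {x. \<exists>u. P x u}"
proof -
  \<comment> \<open>The coordinates in \<open>J\<close> are projected out, but \<open>u\<close>
    keeps its type, so the induction can run over \<open>J\<close>. For \<open>J = UNIV\<close> the
    second component no longer matters and is set to 0.\<close>
  define E where "E J = {(x, u). \<exists>v. (\<forall>i. i \<notin> J \<longrightarrow> v $ i = u $ i) \<and> P x v}" for J :: "'d set"
  have "presburger_set (E J)" if "finite J" for J
    using that
  proof (induction J rule: finite_induct)
    case empty
    have "E {} = {(x, u). P x u}" unfolding E_def by (auto simp flip: vec_eq_iff)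
    then show ?case using assms by simp
  next
    case (insert j J)
    have axis_add: "axis j (s + t) = axis j s + axis j t" for s t :: int
      by (simp add: axis_def vec_eq_iff)
    have "E (insert j J) = {z. \<exists>t. (fst z, snd z + axis j t) \<in> E J}"
    proof (intro set_eqI iffI)
      fix z assume "z \<in> E (insert j J)"
      then obtain v where v: "\<forall>i. i \<notin> insert j J \<longrightarrow> v $ i = snd z $ i" "P (fst z) v"
        unfolding E_def by auto
      have "(fst z, snd z + axis j (v $ j - snd z $ j)) \<in> E J"
        unfolding E_def using v by (auto simp: axis_def)
      then show "z \<in> {z. \<exists>t. (fst z, snd z + axis j t) \<in> E J}" by blast
    next
      fix z assume "z \<in> {z. \<exists>t. (fst z, snd z + axis j t) \<in> E J}"
      then obtain t v where "\<forall>i. i \<notin> J \<longrightarrow> v $ i = (snd z + axis j t) $ i" "P (fst z) v"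
        unfolding E_def by auto
      then have "(\<forall>i. i \<notin> insert j J \<longrightarrow> v $ i = snd z $ i) \<and> P (fst z) v"
        by (simp add: axis_def)
      then show "z \<in> E (insert j J)" unfolding E_def by (cases z) auto
    qed
    moreover have "affine_hom (\<lambda>(z, t :: int). (fst z :: 'a, snd z + axis j t))"
      by (rule affine_hom_additive) (auto simp: axis_add)
    from presburger_set_vimage[OF insert.IH this]
    have "presburger_set {z. \<exists>t. (fst z, snd z + axis j t) \<in> E J}"
      by (intro presburger_set_ex) (simp add: case_prod_unfold)
    ultimately show ?case by simp
  qed
  then have "presburger_set (E UNIV)" by simp
  from presburger_set_vimage[OF this affine_hom_Pair[OF affine_hom_id affine_hom_const[of 0]]]
  show ?thesis by (simp add: E_def)
qed

section \<open>Semisimple sets as Presburger sets\<close>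

lemma presburger_set_ncomb:
  fixes smul :: "int \<Rightarrow> 'g::ab_group_add \<Rightarrow> 'g"
  assumes add: "\<And>s t b. smul (s + t) b = smul s b + smul t b"
    and zero: "presburger_set {0 :: 'g}" and "finite B"
  shows "presburger_set (ncomb smul B)"
  using \<open>finite B\<close>
proof (induction B rule: finite_induct)
  case empty
  then show ?case using zero by (simp add: ncomb_def)
next
  case (insert b B)
  \<comment> \<open>Each generator adds one nonnegative integer coefficient, which is then
    eliminated.\<close>
  have "ncomb smul (insert b B) = {x. \<exists>t. 0 \<le> t \<and> x - smul t b \<in> ncomb smul B}"
  proof (intro set_eqI iffI)
    fix x assume "x \<in> ncomb smul (insert b B)"
    then obtain c where "x = (\<Sum>b\<in>insert b B. smul (int (c b)) b)" unfolding ncomb_def by blast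
    then have "x - smul (int (c b)) b = (\<Sum>b\<in>B. smul (int (c b)) b)" using insert.hyps by simp
    then show "x \<in> {x. \<exists>t. 0 \<le> t \<and> x - smul t b \<in> ncomb smul B}"
      unfolding ncomb_def by (intro CollectI exI[of _ "int (c b)"]) auto
  next
    fix x assume "x \<in> {x. \<exists>t. 0 \<le> t \<and> x - smul t b \<in> ncomb smul B}"
    then obtain t c where t: "0 \<le> t" and "x - smul t b = (\<Sum>b\<in>B. smul (int (c b)) b)"
      unfolding ncomb_def by blast
    moreover have "(\<Sum>b'\<in>B. smul (int ((c(b := nat t)) b')) b') = (\<Sum>b\<in>B. smul (int (c b)) b)"
      using insert.hyps(2) by (intro sum.cong) auto
    ultimately have "x = (\<Sum>b'\<in>insert b B. smul (int ((c(b := nat t)) b')) b')"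
      using insert.hyps by (simp add: algebra_simps)
    then show "x \<in> ncomb smul (insert b B)" unfolding ncomb_def by blast
  qed
  moreover have "affine_hom (\<lambda>(x, t). x - smul t b)"
    by (rule affine_hom_additive) (auto simp: add)
  from presburger_set_Int[OF presburger_set_le[OF affine_hom_const[of 0] affine_hom_snd]
      presburger_set_vimage[OF insert.IH this]]
  have "presburger_set {x. \<exists>t. 0 \<le> t \<and> x - smul t b \<in> ncomb smul B}"
    by (intro presburger_set_ex) (simp add: case_prod_unfold Collect_conj_eq)
  ultimately show ?case by simp
qed

lemma presburger_set_semisimple:
  fixes smul :: "int \<Rightarrow> 'g::ab_group_add \<Rightarrow> 'g"
  assumes "\<And>s t b. smul (s + t) b = smul s b + smul t b" "presburger_set {0 :: 'g}"
    "semisimple smul S"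
  shows "presburger_set S"
proof -
  obtain F where F: "finite F" "\<forall>(q, B)\<in>F. finite B"
    and S: "S = (\<Union>(q, B)\<in>F. (+) q ` ncomb smul B)"
    using assms(3) unfolding semisimple_def by fast
  have "presburger_set ((+) q ` ncomb smul B)" if "(q, B) \<in> F" for q B
  proof -
    have "presburger_set (ncomb smul B)"
      using presburger_set_ncomb[of smul, OF assms(1,2)] F(2) that by blast
    from presburger_set_vimage[OF this affine_hom_diff[OF affine_hom_id affine_hom_const]]
    have "presburger_set {x. x - q \<in> ncomb smul B}" .
    moreover have "{x. x - q \<in> ncomb smul B} = (+) q ` ncomb smul B"
      by (force simp: image_iff)
    ultimately show ?thesis by simp
  qed
  then show ?thesis unfolding S by (intro presburger_set_UN F(1)) auto
qed

lemma presburger_set_zero: "presburger_set {0 :: (int ^ 'k) \<times> (int ^ 'd)}"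
proof -
  have "presburger_set {x :: (int ^ 'k) \<times> (int ^ 'd). fst x $ i = 0}" for i
    by (rule presburger_set_eq[OF affine_hom_comp[OF affine_hom_nth affine_hom_fst] affine_hom_const])
  moreover have "presburger_set {x :: (int ^ 'k) \<times> (int ^ 'd). snd x $ i = 0}" for i
    by (rule presburger_set_eq[OF affine_hom_comp[OF affine_hom_nth affine_hom_snd] affine_hom_const])
  ultimately have "presburger_set ((\<Inter>i\<in>UNIV. {x :: (int ^ 'k) \<times> (int ^ 'd). fst x $ i = 0}) \<inter>
      (\<Inter>i\<in>UNIV. {x. snd x $ i = 0}))"
    by (intro presburger_set_Int presburger_set_INT) auto
  moreover have "\<dots> = {0}" by (auto simp: prod_eq_iff vec_eq_iff)
  ultimately show ?thesis by simp
qed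

lemma semisimple_gsmul_imp_presburger_set: "semisimple gsmul S \<Longrightarrow> presburger_set S"
  by (rule presburger_set_semisimple[of gsmul])
    (auto simp: gsmul_def presburger_set_zero vector_sadd_rdistrib)

section \<open>Least values\<close>

lemma affine_hom_eq_rdot:
  fixes h :: "int ^ 'k \<Rightarrow> int"
  assumes "affine_hom h"
  obtains a b where "\<And>n. of_int (h n) = rdot a n + b"
proof -
  define l where "l n = h n - h 0" for n
  have add: "l (x + y) = l x + l y" for x y
    using affine_homD[OF assms, of x y] unfolding l_def by simp
  have smult: "l (t *s x) = t * l x" for t x
  proof -
    have "affine_hom (\<lambda>t. l (t *s x))"
      by (rule affine_hom_additive) (simp add: vector_sadd_rdistrib add)
    from affine_hom_int_line[OF this, of t] show ?thesis by (simp add: l_def)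
  qed
  have l_sum: "l n = (\<Sum>i\<in>UNIV. n $ i * l (axis i 1))" for n
  proof -
    have "l (\<Sum>i\<in>I. n $ i *s axis i 1) = (\<Sum>i\<in>I. n $ i * l (axis i 1))" for I :: "'k set"
      by (induction I rule: infinite_finite_induct) (simp_all add: add smult, simp_all add: l_def)
    from this[of UNIV] show ?thesis by (simp only: basis_expansion)
  qed
  have "rdot (\<chi> i. of_int (l (axis i 1))) n = of_int (l n)" for n
    by (subst l_sum) (simp add: rdot_def mult.commute)
  then have "of_int (h n) = rdot (\<chi> i. of_int (l (axis i 1))) n + of_int (h 0)" for n
    by (simp add: l_def)
  then show ?thesis by (rule that)
qed

text \<open>Integrality turns \<open>h n > 0\<close> into \<open>h n \<ge> 1\<close>, so strict
  conditions also define closed half-spaces.\<close>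

lemma rat_polyhedron_sign_condition:
  fixes U V :: "(int ^ 'k \<Rightarrow> int) set"
  assumes "finite U" "finite V" "\<And>h. h \<in> U \<union> V \<Longrightarrow> affine_hom h"
  shows "rat_polyhedron {n. (\<forall>h\<in>U. h n \<le> 0) \<and> (\<forall>h\<in>V. h n > 0)}"
proof -
  have "\<exists>a b. \<forall>n. of_int (h n) = rdot a n + b" if "h \<in> U \<union> V" for h
    using affine_hom_eq_rdot[OF assms(3)[OF that]] by metis
  then obtain a b where ab: "\<And>h n. h \<in> U \<union> V \<Longrightarrow> of_int (h n) = rdot (a h) n + (b h :: rat)"
    by metis
  have neg: "rdot (- x) n = - rdot x n" for x and n :: "int ^ 'k"
    by (simp add: rdot_def sum_negf)
  have U: "h n \<le> 0 \<longleftrightarrow> rdot (a h) n \<le> - b h" if "h \<in> U" for h n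
  proof -
    have "h n \<le> 0 \<longleftrightarrow> of_int (h n) \<le> (0 :: rat)" by simp
    also have "of_int (h n) = rdot (a h) n + b h" using ab that by blast
    also have "\<dots> \<le> 0 \<longleftrightarrow> rdot (a h) n \<le> - b h" by linarith
    finally show ?thesis .
  qed
  have V: "h n > 0 \<longleftrightarrow> rdot (- a h) n \<le> b h - 1" if "h \<in> V" for h n
  proof -
    have "h n > 0 \<longleftrightarrow> 1 \<le> h n" by linarith
    also have "\<dots> \<longleftrightarrow> (1 :: rat) \<le> of_int (h n)" by simp
    also have "of_int (h n) = rdot (a h) n + b h" using ab that by blast
    also have "1 \<le> \<dots> \<longleftrightarrow> rdot (- a h) n \<le> b h - 1" unfolding neg by linarith
    finally show ?thesis .
  qed
  define E where "E = (\<lambda>h. (a h, - b h)) ` U \<union> (\<lambda>h. (- a h, b h - 1)) ` V"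
  have "finite E" unfolding E_def using assms(1,2) by simp
  moreover have "{n. (\<forall>h\<in>U. h n \<le> 0) \<and> (\<forall>h\<in>V. h n > 0)} = {n. \<forall>(a, b)\<in>E. rdot a n \<le> b}"
    unfolding E_def by (simp add: U V ball_Un)
  ultimately show ?thesis unfolding rat_polyhedron_def by blast
qed

text \<open>Cosets of \<open>L\<close> are the fibres of the map sending a point to its residues
  modulo \<open>m\<close> under the functions in \<open>H\<close>, and there are finitely many
  residue vectors.\<close>

lemma residue_lattice:
  fixes H :: "(int ^ 'k \<Rightarrow> int) set"
  assumes "finite H" "\<And>h. h \<in> H \<Longrightarrow> affine_hom h" "m > 0"
  defines "L \<equiv> {x. \<forall>h\<in>H. m dvd h x - h 0}"
  shows "is_subgroup L" "finite_index L"
proof -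
  have diff: "h (x - y) - h 0 = h x - h y" if "h \<in> H" for h x y
    using affine_homD[OF assms(2)[OF that], of "x - y" y] by simp
  have "m dvd h (x - y) - h 0" if "h \<in> H" "x \<in> L" "y \<in> L" for h x y
  proof -
    have "m dvd (h x - h 0) - (h y - h 0)" using that unfolding L_def by (intro dvd_diff[of m "h x - h 0"]) auto
    then show ?thesis using diff[OF that(1)] by simp
  qed
  then show "is_subgroup L" unfolding is_subgroup_def L_def by simp
  define \<rho> where "\<rho> x = restrict (\<lambda>h. h x mod m) H" for x
  have coset: "(+) x ` L = {y. y - x \<in> L}" for x by (force simp: image_iff)
  have "(+) x ` L = {y. \<rho> y = \<rho> x}" for x
  proof -
    have "y - x \<in> L \<longleftrightarrow> \<rho> y = \<rho> x" for y
      unfolding L_def \<rho>_def using diff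
      by (auto simp: mod_eq_dvd_iff restrict_def fun_eq_iff)
    then show ?thesis unfolding coset by simp
  qed
  then have "{(+) x ` L | x. True} \<subseteq> (\<lambda>r. {y. \<rho> y = r}) ` range \<rho>" by auto
  moreover have "range \<rho> \<subseteq> (\<Pi>\<^sub>E h\<in>H. {0..<m})" unfolding \<rho>_def using assms(3) by auto
  then have "finite (range \<rho>)" by (rule finite_subset) (simp add: finite_PiE assms(1))
  ultimately show "finite_index L" unfolding finite_index_def by (meson finite_imageI finite_subset)
qed

text \<open>On a polyhedron cut out by signs, intersected with a coset of the residue lattice, one
  and the same equation \<open>h (n, t) = r\<close> determines the minimum. Solving it divides by
  the coefficient of \<open>t\<close>, hence the rational slopes.\<close>

theorem least_piecewise_quasilinear:
  fixes S :: "((int ^ 'k) \<times> int) set"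
  assumes "presburger_set S"
  shows "piecewise_quasilinear_on {n. \<exists>t. (n, t) \<in> S \<and> (\<forall>s. (n, s) \<in> S \<longrightarrow> t \<le> s)}
    (\<lambda>n. LEAST t. (n, t) \<in> S)"
proof -
  obtain H m where fin: "finite H" and "\<forall>h\<in>H. affine_hom h" and m: "m > 0"
    and dec: "decided_by H m S"
    using assms by (elim presburger_setE)
  then have aff: "\<And>h. h \<in> H \<Longrightarrow> affine_hom h" by simp
  define c where "c h = h (0, 1) - h (0, 0)" for h :: "(int ^ 'k) \<times> int \<Rightarrow> int"
  define N where "N = (\<Sum>h\<in>H. \<bar>c h\<bar> * m)"
  have N: "\<bar>c h\<bar> * m \<le> N" if "h \<in> H" for h
    unfolding N_def using member_le_sum[of h H "\<lambda>h. \<bar>c h\<bar> * m"] that fin m by simp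
  define K where "K = {h \<in> H. c h \<noteq> 0} \<times> {-N..N}"
  define Mn where "Mn = {(n, t). (n, t) \<in> S \<and> (\<forall>s. (n, s) \<in> S \<longrightarrow> t \<le> s)}"
  text \<open>If \<open>t\<close> is minimal over \<open>n\<close>, then \<open>(n, t - m)\<close> lies outside \<open>S\<close>, so some sign changes
    between \<open>t - m\<close> and \<open>t\<close>; this leaves finitely many affine candidates for \<open>t\<close>.\<close>
  have candidate: "\<exists>(h, r)\<in>K. h (n, t) = r" if "(n, t) \<in> Mn" for n t
  proof -
    have t: "(n, t) \<in> S" "\<And>s. (n, s) \<in> S \<Longrightarrow> t \<le> s" using that by (auto simp: Mn_def)
    have "(n, t - m) \<notin> S" using t(2)[of "t - m"] m by auto
    then have "\<not> same_type H m (n, t) (n, t - m)" using dec t(1) unfolding decided_by_def by blast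
    from step_near_threshold[OF aff m this] obtain h
      where h: "h \<in> H" "c h \<noteq> 0" "\<bar>h (n, t)\<bar> \<le> \<bar>c h\<bar> * m" unfolding c_def by blast
    then have "(h, h (n, t)) \<in> K" unfolding K_def using N[OF h(1)] by auto
    then show ?thesis by blast
  qed
  \<comment> \<open>The points whose minimum satisfies a given candidate equation. These sets cover
    the domain but may overlap.\<close>
  define D where "D = (\<lambda>(h, r :: int). {n. \<exists>t. (n, t) \<in> Mn \<and> h (n, t) = r})"
  have "affine_hom (\<lambda>((n :: int ^ 'k, t :: int), s :: int). (n, s))"
    "affine_hom (\<lambda>((n :: int ^ 'k, t :: int), s :: int). s + 1)"
    "affine_hom (\<lambda>((n :: int ^ 'k, t :: int), s :: int). t)"
    by (auto simp: affine_hom_def zero_prod_def)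
  \<comment> \<open>Minimality is expressed by removing every pair with a smaller value
    \<open>s\<close> over the same \<open>n\<close>; \<open>s + 1 \<le> t\<close> encodes
    \<open>s < t\<close>.\<close>
  then have "presburger_set ({z. (\<lambda>((n, t), s). (n, s)) z \<in> S} \<inter>
      {z. (\<lambda>((n, t), s). s + 1) z \<le> (\<lambda>((n :: int ^ 'k, t :: int), s :: int). t) z})"
    by (intro presburger_set_Int presburger_set_vimage[OF assms] presburger_set_le)
  then have "presburger_set {z. \<exists>s. (fst z, s) \<in> S \<and> s + 1 \<le> snd z}"
    by (intro presburger_set_ex) (simp add: case_prod_unfold Collect_conj_eq)
  then have "presburger_set (S - {z. \<exists>s. (fst z, s) \<in> S \<and> s + 1 \<le> snd z})"
    by (rule presburger_set_Diff[OF assms])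
  moreover have "Mn = S - {z. \<exists>s. (fst z, s) \<in> S \<and> s + 1 \<le> snd z}"
    unfolding Mn_def by force
  ultimately have Mn: "presburger_set Mn" by simp
  have "presburger_set (D k)" if "k \<in> K" for k
  proof -
    obtain h r where k: "k = (h, r)" "h \<in> H" using \<open>k \<in> K\<close> unfolding K_def by auto
    have "presburger_set (Mn \<inter> {z. h z = r})"
      by (intro presburger_set_Int Mn presburger_set_eq[OF aff[OF k(2)] affine_hom_const])
    moreover have "Mn \<inter> {z. h z = r} = {(n, t). (n, t) \<in> Mn \<and> h (n, t) = r}" by auto
    ultimately show ?thesis unfolding D_def k(1) by (auto intro!: presburger_set_ex)
  qed
  then have "\<forall>k\<in>K. presburger_set (D k)" by blast
  moreover have "finite K" unfolding K_def using fin by simp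
  ultimately obtain H' m' where fin': "finite H'" and "\<forall>h\<in>H'. affine_hom h" and m': "m' > 0"
    and dec': "\<forall>k\<in>K. decided_by H' m' (D k)"
    using presburger_set_common[of K D] by (elim meta_impE exE conjE) auto
  then have aff': "\<And>h. h \<in> H' \<Longrightarrow> affine_hom h" by simp
  define L where "L = {x. \<forall>h\<in>H'. m' dvd h x - h 0}"
  \<comment> \<open>One polyhedron for each sign pattern, \<open>U\<close> being the set of
    functions that are nonpositive.\<close>
  define poly where "poly U = {n. (\<forall>h\<in>U. h n \<le> 0) \<and> (\<forall>h\<in>H' - U. h n > 0)}" for U
  let ?Dom = "{n. \<exists>t. (n, t) \<in> S \<and> (\<forall>s. (n, s) \<in> S \<longrightarrow> t \<le> s)}"
  have least: "(n, t) \<in> Mn \<Longrightarrow> (LEAST t. (n, t) \<in> S) = t" for n t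
    unfolding Mn_def by (intro Least_equality) auto
  have sign: "h n \<le> 0 \<longleftrightarrow> h \<in> U" if "h \<in> H'" "n \<in> poly U" for h n U
  proof (cases "h \<in> U")
    case False
    then have "h n > 0" using that unfolding poly_def by blast
    then show ?thesis using False by simp
  qed (use that in \<open>simp add: poly_def\<close>)
  have same: "same_type H' m' n n'"
    if "U \<in> Pow H'" "n \<in> poly U" "n' \<in> poly U" "n - x \<in> L" "n' - x \<in> L" for U n n' x
  proof -
    have "(h n \<le> 0 \<longleftrightarrow> h n' \<le> 0) \<and> m' dvd h n - h n'" if h: "h \<in> H'" for h
    proof
      show "h n \<le> 0 \<longleftrightarrow> h n' \<le> 0"
        using sign[OF h \<open>n \<in> poly U\<close>] sign[OF h \<open>n' \<in> poly U\<close>] by simp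
      have "m' dvd (h (n - x) - h 0) - (h (n' - x) - h 0)"
        using h \<open>n - x \<in> L\<close> \<open>n' - x \<in> L\<close> unfolding L_def
        by (intro dvd_diff[of m' "h (n - x) - h 0"]) auto
      also have "\<dots> = h n - h n'"
        using affine_homD[OF aff'[OF h], of "n - x" x] affine_homD[OF aff'[OF h], of "n' - x" x]
        by simp
      finally show "m' dvd h n - h n'" .
    qed
    then show ?thesis unfolding same_type_def by blast
  qed
  have "\<exists>(a :: rat ^ 'k) b. \<forall>n\<in>poly U \<inter> ?Dom. n - x \<in> L \<longrightarrow>
      of_int (LEAST t. (n, t) \<in> S) = rdot a n + b" if U: "U \<in> Pow H'" for U x
  \<comment> \<open>If the piece meets the domain, a single point \<open>n0\<close> fixes the
    candidate for all others, since they have the same type; otherwise the claim is vacuous.\<close>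
  proof (cases "\<exists>n0\<in>poly U \<inter> ?Dom. n0 - x \<in> L")
    case True
    then obtain n0 t0 where n0: "n0 \<in> poly U" "n0 - x \<in> L" "(n0, t0) \<in> Mn"
      unfolding Mn_def by blast
    obtain h r where hr: "(h, r) \<in> K" "h (n0, t0) = r" using candidate[OF n0(3)] by blast
    then have h: "h \<in> H" "c h \<noteq> 0" by (auto simp: K_def)
    have "affine_hom (\<lambda>n. h (n, 0))"
      by (rule affine_hom_comp[OF aff[OF h(1)] affine_hom_Pair[OF affine_hom_id affine_hom_const]])
    from affine_hom_eq_rdot[OF this] obtain a b where ab: "\<And>n. of_int (h (n, 0)) = rdot a n + b"
      by blast
    have "of_int (LEAST t. (n, t) \<in> S) =
        rdot (\<chi> i. - a $ i / of_int (c h)) n + (of_int r - b) / of_int (c h)"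
      if n: "n \<in> poly U \<inter> ?Dom" "n - x \<in> L" for n
    proof -
      have "n0 \<in> D (h, r)" unfolding D_def using n0(3) hr(2) by auto
      moreover have "same_type H' m' n0 n" using same[OF U] n n0 by blast
      ultimately have "n \<in> D (h, r)" using dec' hr(1) unfolding decided_by_def by blast
      then obtain t where t: "(n, t) \<in> Mn" "h (n, t) = r" unfolding D_def by auto
      have "r = h (n, 0) + c h * t"
        using affine_hom_prod_int[OF aff[OF h(1)], of n t] t(2) unfolding c_def by simp
      then have "of_int r = rdot a n + b + of_int (c h) * (of_int t :: rat)"
        by (simp flip: ab)
      then have "of_int t = (- rdot a n) / of_int (c h) + (of_int r - b) / of_int (c h)"
        using h(2) by (simp add: field_simps)
      also have "(- rdot a n) / of_int (c h) = rdot (\<chi> i. - a $ i / of_int (c h)) n"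
        by (simp add: rdot_def sum_negf sum_divide_distrib)
      finally show ?thesis using least[OF t(1)] by simp
    qed
    then show ?thesis by blast
  qed blast
  then have "\<forall>P\<in>poly ` Pow H'. \<exists>L. is_subgroup L \<and> finite_index L \<and>
      (\<forall>x. \<exists>(a :: rat ^ 'k) b. \<forall>n\<in>P \<inter> ?Dom. n - x \<in> L \<longrightarrow>
        of_int (LEAST t. (n, t) \<in> S) = rdot a n + b)"
    using residue_lattice[OF fin' aff' m'] unfolding L_def by blast
  moreover have "\<forall>P\<in>poly ` Pow H'. rat_polyhedron P"
    unfolding poly_def using fin' aff'
    by (auto intro!: rat_polyhedron_sign_condition intro: finite_subset)
  moreover have "\<Union> (poly ` Pow H') = UNIV"
  proof -
    have "n \<in> \<Union> (poly ` Pow H')" for n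
      by (rule UN_I[of "{h \<in> H'. h n \<le> 0}"]) (auto simp: poly_def)
    then show ?thesis by auto
  qed
  moreover have "finite (poly ` Pow H')" using fin' by simp
  ultimately show ?thesis unfolding piecewise_quasilinear_on_def by (intro exI[of _ "poly ` Pow H'"] conjI)
qed


section \<open>Annihilators in constructible families\<close>

text \<open>A scalar multiple vanishes only if the scalar or the vector does, so \<open>r\<close>
  kills \<open>f\<close> exactly when every monomial in its support does.\<close>

lemma annihilator_eq:
  assumes "vector_space sc"
  shows "annihilator sc Qp act u f =
    {r. Poly_Mapping.keys r \<subseteq> {a \<in> Qp. act a u f = 0}}"
proof -
  interpret vector_space sc by fact
  show ?thesis
    unfolding annihilator_def sgring_def by (auto simp: in_keys_iff)
qed

text \<open>Single monomials test membership of exponents. Comparing annihilators thus becomes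
  comparing sets of exponents.\<close>

lemma keys_subset_Collect_eq_iff:
  "{r :: 'a \<Rightarrow>\<^sub>0 'b::zero_neq_one. Poly_Mapping.keys r \<subseteq> A} = {r. Poly_Mapping.keys r \<subseteq> B} \<longleftrightarrow> A = B"
proof
  assume eq: "{r :: 'a \<Rightarrow>\<^sub>0 'b. Poly_Mapping.keys r \<subseteq> A} = {r. Poly_Mapping.keys r \<subseteq> B}"
  have "a \<in> A \<longleftrightarrow> a \<in> B" for a
  proof -
    have "Poly_Mapping.single a (1 :: 'b) \<in> {r. Poly_Mapping.keys r \<subseteq> A} \<longleftrightarrow>
        Poly_Mapping.single a (1 :: 'b) \<in> {r. Poly_Mapping.keys r \<subseteq> B}"
      using eq by simp
    then show ?thesis by simp
  qed
  then show "A = B" by blast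
qed simp

lemma lin_iso_zero:
  assumes "lin_iso sc f A B" "0 \<in> A"
  shows "f 0 = 0"
proof -
  have "f (0 + 0) = f 0 + f 0" using assms unfolding lin_iso_def by blast
  then show ?thesis by simp
qed

text \<open>Whether \<open>t\<^sup>a\<close> kills an element coming from \<open>x \<in> MI I\<close> depends only on \<open>x\<close> and on the region that
  the product lands in, so up to finitely many choices of a union \<open>W\<close> of regions, the monomials
  killing an element of degree \<open>(n, u)\<close> are those moving \<open>(n, u)\<close> into \<open>W\<close>.\<close>
lemma constructible_family_killing_regions:
  fixes M :: "int ^ 'k \<Rightarrow> int ^ 'd \<Rightarrow> 'v::ab_group_add set"
  assumes vs: "vector_space sc" and "constructible_family sc Qp M act"
  shows "\<exists>P \<W>. finite P \<and> \<Union> P = UNIV \<and>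
    (\<forall>I\<in>P. presburger_set I \<and> finite (\<W> I) \<and> (\<forall>W\<in>\<W> I. presburger_set W)) \<and>
    (\<forall>I\<in>P. \<forall>n u. (n, u) \<in> I \<longrightarrow>
      (\<lambda>f. {a \<in> Qp. act n a u f = 0}) ` M n u = (\<lambda>W. {a \<in> Qp. (n, u + a) \<in> W}) ` \<W> I)"
proof -
  interpret vector_space sc by fact
  obtain C actN where "presburger_cone gsmul C" and slice: "C \<inter> {x. fst x = 0} = {(0, a) | a. a \<in> Qp}"
    and gm: "graded_module sc C (\<lambda>(n, q). M n q) actN"
    and actN_eq: "\<forall>n q. \<forall>a\<in>Qp. \<forall>x\<in>M n q. actN (0, a) (n, q) x = act n a q x"
    and cm: "constructible_module sc gsmul C (\<lambda>(n, q). M n q) actN"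
    using assms(2) unfolding constructible_family_def by (elim exE conjE)
  have actN: "actN (0, a) (n, q) x = act n a q x" if "a \<in> Qp" "x \<in> M n q" for n q a x
    using actN_eq that by blast
  obtain P :: "((int ^ 'k) \<times> (int ^ 'd)) set set" and MI \<phi>
    where P: "finite P" "\<Union> P = UNIV" "\<forall>I\<in>P. \<forall>J\<in>P. I \<noteq> J \<longrightarrow> I \<inter> J = {}"
      "\<forall>I\<in>P. semisimple gsmul I"
    and sub: "\<forall>I\<in>P. subspace (MI I)"
    and iso_all: "\<forall>I\<in>P. \<forall>g\<in>I. lin_iso sc (\<phi> I g) (MI I) ((\<lambda>(n, q). M n q) g)"
    and ex_T: "\<forall>I\<in>P. \<forall>J\<in>P. \<exists>T. \<forall>g\<in>I. \<forall>h\<in>J. h - g \<in> C \<longrightarrow>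
      (\<forall>x\<in>MI I. the_inv_into (MI J) (\<phi> J h) (actN (h - g) g (\<phi> I g x)) = T x)"
    using conjunct2[OF cm[unfolded constructible_module_def]] by (elim conjE exE)
  have iso: "lin_iso sc (\<phi> I (n, q)) (MI I) (M n q)" if "I \<in> P" "(n, q) \<in> I" for I n q
    using bspec[OF bspec[OF iso_all that(1)] that(2)] by simp
  obtain T where T: "\<forall>I\<in>P. \<forall>J\<in>P. \<forall>g\<in>I. \<forall>h\<in>J. h - g \<in> C \<longrightarrow>
      (\<forall>x\<in>MI I. the_inv_into (MI J) (\<phi> J h) (actN (h - g) g (\<phi> I g x)) = T I J x)"
    using ex_T[unfolded bchoice_iff] by (elim exE)
  have grading: "\<forall>c\<in>C. \<forall>g. \<forall>x\<in>(\<lambda>(n, q). M n q) g. actN c g x \<in> (\<lambda>(n, q). M n q) (g + c)"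
    using gm unfolding graded_module_def by (elim conjE)
  define kill where "kill I x = \<Union> {J \<in> P. T I J x = 0}" for I x
  have kills: "act n a u (\<phi> I (n, u) x) = 0 \<longleftrightarrow> (n, u + a) \<in> kill I x"
    if I: "I \<in> P" "(n, u) \<in> I" and x: "x \<in> MI I" and a: "a \<in> Qp" for I n u x a
  proof -
    have "(n, u + a) \<in> \<Union> P" using P(2) by simp
    then obtain J where J: "J \<in> P" "(n, u + a) \<in> J" unfolding Union_iff by (elim bexE)
    have bij: "bij_betw (\<phi> J (n, u + a)) (MI J) (M n (u + a))"
      using iso[OF J] unfolding lin_iso_def by blast
    have x': "\<phi> I (n, u) x \<in> M n u"
      using iso[OF I] x unfolding lin_iso_def bij_betw_def by blast
    have C: "(0, a) \<in> C" using slice a by blast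
    define y where "y = act n a u (\<phi> I (n, u) x)"
    have y: "actN (0, a) (n, u) (\<phi> I (n, u) x) = y" unfolding y_def by (rule actN[OF a x'])
    have yM: "y \<in> M n (u + a)"
      using bspec[OF spec[OF bspec[OF grading C], of "(n, u)"], of "\<phi> I (n, u) x"] x' y by simp
    \<comment> \<open>Pull the product back to \<open>MI J\<close>, where it is
      \<open>T I J x\<close>. Both \<phi> and its inverse send 0 to 0, so vanishing can be tested
      there.\<close>
    have "the_inv_into (MI J) (\<phi> J (n, u + a)) y = T I J x"
      using T[rule_format, OF I(1) J(1) I(2) J(2) _ x] C y by simp
    moreover have "\<phi> J (n, u + a) (the_inv_into (MI J) (\<phi> J (n, u + a)) y) = y"
      by (rule f_the_inv_into_f_bij_betw[OF bij]) (use yM in simp)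
    moreover have "\<phi> J (n, u + a) 0 = 0" "0 \<in> MI J"
      using lin_iso_zero[OF iso[OF J]] subspace_0[OF bspec[OF sub J(1)]] by auto
    moreover have "the_inv_into (MI J) (\<phi> J (n, u + a)) (\<phi> J (n, u + a) 0) = 0"
      using the_inv_into_f_f[OF bij_betw_imp_inj_on[OF bij] \<open>0 \<in> MI J\<close>] .
    ultimately have "y = 0 \<longleftrightarrow> T I J x = 0" by metis
    also have "T I J x = 0 \<longleftrightarrow> (n, u + a) \<in> kill I x"
    proof
      assume "(n, u + a) \<in> kill I x"
      then obtain J' where J': "J' \<in> P" "T I J' x = 0" "(n, u + a) \<in> J'" unfolding kill_def by blast
      \<comment> \<open>Regions are disjoint, so only one of them contains the degree of the
        product.\<close>
      then have "J' = J" using P(3) J by blast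
      then show "T I J x = 0" using J'(2) by simp
    qed (use J in \<open>auto simp: kill_def\<close>)
    finally show ?thesis unfolding y_def .
  qed
  have pres: "presburger_set I" if "I \<in> P" for I
    using semisimple_gsmul_imp_presburger_set P(4) that by blast
  \<comment> \<open>\<open>MI I\<close> may be infinite, but each killing set is a union of some of
    the finitely many regions.\<close>
  have "finite (kill I ` MI I)" for I
    by (rule finite_subset[of _ "Union ` Pow P"]) (use P(1) in \<open>auto simp: kill_def\<close>)
  moreover have "presburger_set (kill I x)" for I x
  proof -
    have "presburger_set (\<Union>J\<in>{J \<in> P. T I J x = 0}. J)"
      using P(1) pres by (intro presburger_set_UN) auto
    then show ?thesis by (simp add: kill_def)
  qed
  moreover have "(\<lambda>f. {a \<in> Qp. act n a u f = 0}) ` M n u =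
      (\<lambda>W. {a \<in> Qp. (n, u + a) \<in> W}) ` kill I ` MI I"
    if I: "I \<in> P" "(n, u) \<in> I" for I n u
  proof -
    have "M n u = \<phi> I (n, u) ` MI I"
      using iso[OF I] unfolding lin_iso_def bij_betw_def by blast
    moreover have "{a \<in> Qp. act n a u (\<phi> I (n, u) x) = 0} = {a \<in> Qp. (n, u + a) \<in> kill I x}"
      if "x \<in> MI I" for x
      using kills[OF I that] by blast
    ultimately show ?thesis by (simp add: image_image cong: image_cong)
  qed
  ultimately show ?thesis
    using P(1,2) pres by (intro exI[of _ P] exI[of _ "\<lambda>I. kill I ` MI I"]) simp
qed

text \<open>If the locus is nonempty, the set of monomials in \<open>p\<close> is itself Presburger, because a witness
  \<open>p = 0 :\<^sub>R f\<close> cuts it out by a killing region.\<close>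
lemma presburger_set_annihilator_locus:
  fixes M :: "int ^ 'k \<Rightarrow> int ^ 'd \<Rightarrow> 'v::ab_group_add set"
  assumes vs: "vector_space sc" and cf: "constructible_family sc Qp M act"
  shows "presburger_set {(n, u). \<exists>f\<in>M n u. p = annihilator sc Qp (act n) u f}" (is "presburger_set ?S")
proof (cases "?S = {}")
  case True
  then show ?thesis using presburger_set_empty by metis
next
  case False
  then obtain n0 u0 f0 where f0: "f0 \<in> M n0 u0" "p = annihilator sc Qp (act n0) u0 f0" by blast
  define A where "A = {a \<in> Qp. act n0 a u0 f0 = 0}"
  obtain P \<W> where P: "finite P" "\<Union> P = UNIV"
    and W: "\<forall>I\<in>P. presburger_set I \<and> finite (\<W> I) \<and> (\<forall>W\<in>\<W> I. presburger_set W)"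
    and kill_all: "\<forall>I\<in>P. \<forall>n u. (n, u) \<in> I \<longrightarrow>
      (\<lambda>f. {a \<in> Qp. act n a u f = 0}) ` M n u = (\<lambda>W. {a \<in> Qp. (n, u + a) \<in> W}) ` \<W> I"
    using constructible_family_killing_regions[OF vs cf] by (elim exE conjE)
  have W_pres: "presburger_set V" if "I \<in> P" "V \<in> \<W> I" for I V
    using W that by simp
  have kill: "(\<lambda>f. {a \<in> Qp. act n a u f = 0}) ` M n u = (\<lambda>W. {a \<in> Qp. (n, u + a) \<in> W}) ` \<W> I"
    if "I \<in> P" "(n, u) \<in> I" for I n u
    using kill_all that by simp
  have Qp: "presburger_set Qp"
  proof -
    obtain C actN where cone: "presburger_cone gsmul C"
      and slice: "C \<inter> {x. fst x = 0} = {(0, a) | a. a \<in> Qp}"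
      and "graded_module sc C (\<lambda>(n, q). M n q) actN"
      and "\<forall>n q. \<forall>a\<in>Qp. \<forall>x\<in>M n q. actN (0, a) (n, q) x = act n a q x"
      and "constructible_module sc gsmul C (\<lambda>(n, q). M n q) actN"
      using cf unfolding constructible_family_def by (elim exE conjE)
    \<comment> \<open>\<open>Qp\<close> is the slice of the cone over 0, hence an affine preimage of
      a semisimple set.\<close>
    from cone have "presburger_set C"
      unfolding presburger_cone_def by (elim conjE) (rule semisimple_gsmul_imp_presburger_set)
    from presburger_set_vimage[OF this affine_hom_Pair[OF affine_hom_const[of 0] affine_hom_id]]
    have "presburger_set {a. (0, a) \<in> C}" .
    moreover have "{a. (0, a) \<in> C} = Qp" using slice by (auto simp: set_eq_iff)
    ultimately show ?thesis by simp
  qed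
  have A: "presburger_set A"
  proof -
    have "(n0, u0) \<in> \<Union> P" using P(2) by simp
    then obtain I where I: "I \<in> P" "(n0, u0) \<in> I" unfolding Union_iff by (elim bexE)
    have "A \<in> (\<lambda>f. {a \<in> Qp. act n0 a u0 f = 0}) ` M n0 u0" unfolding A_def using f0(1) by blast
    then obtain V where V: "V \<in> \<W> I" "A = {a \<in> Qp. (n0, u0 + a) \<in> V}" unfolding kill[OF I] by blast
    have "presburger_set (Qp \<inter> {a. (n0, u0 + a) \<in> V})"
      by (intro presburger_set_Int Qp presburger_set_vimage[OF W_pres[OF I(1) V(1)]] affine_hom_Pair
          affine_hom_add affine_hom_const affine_hom_id)
    then show ?thesis using V(2) by (simp add: Collect_conj_eq)
  qed
  \<comment> \<open>As \<open>A\<close> lies in \<open>Qp\<close>, equality of sets becomes a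
    universally quantified equivalence.\<close>
  have A_iff: "A = {a \<in> Qp. (n, u + a) \<in> V} \<longleftrightarrow>
      (\<forall>a. a \<in> Qp \<longrightarrow> ((n, u + a) \<in> V \<longleftrightarrow> a \<in> A))" for n u V
    unfolding A_def by blast
  define R where "R I V = I \<inter> {z. \<forall>a. a \<in> Qp \<longrightarrow> ((fst z, snd z + a) \<in> V \<longleftrightarrow> a \<in> A)}"
    for I V :: "((int ^ 'k) \<times> (int ^ 'd)) set"
  have "presburger_set (R I V)" if "I \<in> P" "V \<in> \<W> I" for I V
  proof -
    let ?B = "{w. snd w \<in> Qp} :: (((int ^ 'k) \<times> (int ^ 'd)) \<times> (int ^ 'd)) set"
    let ?V = "{w. (fst (fst w), snd (fst w) + snd w) \<in> V} ::
      (((int ^ 'k) \<times> (int ^ 'd)) \<times> (int ^ 'd)) set"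
    let ?A = "{w. snd w \<in> A} :: (((int ^ 'k) \<times> (int ^ 'd)) \<times> (int ^ 'd)) set"
    have V: "presburger_set ?V"
      by (rule presburger_set_vimage[OF W_pres[OF that]]) (auto simp: affine_hom_def)
    have B: "presburger_set ?B" and A': "presburger_set ?A"
      by (rule presburger_set_vimage[OF Qp affine_hom_snd], rule presburger_set_vimage[OF A affine_hom_snd])
    \<comment> \<open>The universal quantifier is handled as the complement of an existential one;
      the two intersections are the two ways in which the equivalence can fail.\<close>
    have "presburger_set (- (- (?B \<inter> ?V \<inter> - ?A) \<inter> - (?B \<inter> - ?V \<inter> ?A)))"
      by (intro presburger_set_Int presburger_set_Compl V B A')
    moreover have "- (- (?B \<inter> ?V \<inter> - ?A) \<inter> - (?B \<inter> - ?V \<inter> ?A)) =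
        {(z, a). \<not> (a \<in> Qp \<longrightarrow> ((fst z, snd z + a) \<in> V \<longleftrightarrow> a \<in> A))}" by auto
    ultimately have "presburger_set {z. \<exists>a. \<not> (a \<in> Qp \<longrightarrow> ((fst z, snd z + a) \<in> V \<longleftrightarrow> a \<in> A))}"
      by (intro presburger_set_ex_vec) simp
    then have "presburger_set (I - {z. \<exists>a. \<not> (a \<in> Qp \<longrightarrow> ((fst z, snd z + a) \<in> V \<longleftrightarrow> a \<in> A))})"
      by (rule presburger_set_Diff[OF W[rule_format, OF that(1), THEN conjunct1]])
    moreover have "I - {z. \<exists>a. \<not> (a \<in> Qp \<longrightarrow> ((fst z, snd z + a) \<in> V \<longleftrightarrow> a \<in> A))} = R I V"
      unfolding R_def by blast
    ultimately show ?thesis by simp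
  qed
  then have "presburger_set (\<Union>I\<in>P. \<Union>V\<in>\<W> I. R I V)"
    using W P(1) by (intro presburger_set_UN) simp_all
  moreover have "?S = (\<Union>I\<in>P. \<Union>V\<in>\<W> I. R I V)"
  proof -
    have "(n, u) \<in> ?S \<longleftrightarrow> (n, u) \<in> (\<Union>I\<in>P. \<Union>V\<in>\<W> I. R I V)" for n u
    proof -
      have "(n, u) \<in> ?S \<longleftrightarrow> (\<exists>f\<in>M n u. A = {a \<in> Qp. act n a u f = 0})"
        unfolding f0(2) annihilator_eq[OF vs] keys_subset_Collect_eq_iff A_def by simp
      also have "\<dots> \<longleftrightarrow> A \<in> (\<lambda>f. {a \<in> Qp. act n a u f = 0}) ` M n u" by blast
      also have "\<dots> \<longleftrightarrow> (\<exists>I\<in>P. (n, u) \<in> I \<and> A \<in> (\<lambda>V. {a \<in> Qp. (n, u + a) \<in> V}) ` \<W> I)"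
        using P(2) kill by (metis (no_types, lifting) UNIV_I UnionE)
      also have "\<dots> \<longleftrightarrow> (\<exists>I\<in>P. \<exists>V\<in>\<W> I. (n, u) \<in> I \<and> A = {a \<in> Qp. (n, u + a) \<in> V})" by blast
      also have "\<dots> \<longleftrightarrow> (n, u) \<in> (\<Union>I\<in>P. \<Union>V\<in>\<W> I. R I V)"
        unfolding R_def by (simp add: A_iff)
      finally show ?thesis .
    qed
    then show ?thesis by (simp only: set_eq_iff split_paired_all) simp
  qed
  ultimately show ?thesis by simp
qed

section \<open>Minimizing the linear function over the locus\<close>

theorem theorem9p27:
  fixes sc :: "'F::field \<Rightarrow> 'v::ab_group_add \<Rightarrow> 'v"
    and Qp :: "(int ^ 'd) set"
    and M :: "int ^ 'k \<Rightarrow> int ^ 'd \<Rightarrow> 'v set"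
    and act :: "int ^ 'k \<Rightarrow> int ^ 'd \<Rightarrow> int ^ 'd \<Rightarrow> 'v \<Rightarrow> 'v"
    and p :: "((int ^ 'd) \<Rightarrow>\<^sub>0 'F) set"
    and lam :: "int ^ 'd \<Rightarrow> int"
  assumes "vector_space sc"
    and "affine_semigroup Qp"
    and "group_of_monoid Qp = UNIV"
    and "\<And>n. graded_module sc Qp (M n) (act n)"
    and "constructible_family sc Qp M act"
    and "prime_ideal_in (sgring Qp) p"
    and "monomial_ideal Qp p"
    and "\<And>x y. lam (x + y) = lam x + lam y"
  shows "piecewise_quasilinear_on
           {n. v_defined sc Qp (M n) (act n) p lam}
           (\<lambda>n. v_inv sc Qp (M n) (act n) p lam)"
proof -
  define S where "S = {(n, u). \<exists>f\<in>M n u. p = annihilator sc Qp (act n) u f}"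
  have S: "presburger_set S"
    unfolding S_def by (rule presburger_set_annihilator_locus[OF assms(1,5)])
  \<comment> \<open>The image of the locus under \<open>(n, u) \<mapsto> (n, lam u)\<close>. Its
    fibre over \<open>n\<close> is the set whose minimum is the v-invariant, so the domain of
    definition matches too.\<close>
  define V where "V = {z :: (int ^ 'k) \<times> int. \<exists>u. (fst z, u) \<in> S \<and> lam u = snd z}"
  have V_iff: "(n, t) \<in> V \<longleftrightarrow> t \<in> vset sc Qp (M n) (act n) p lam" for n t
    unfolding V_def S_def vset_def by auto
  have lam: "affine_hom lam" by (rule affine_hom_additive[OF assms(8)])
  have "affine_hom (\<lambda>(z :: (int ^ 'k) \<times> int, u :: int ^ 'd). (fst z, u))"
    by (auto simp: affine_hom_def zero_prod_def)
  then have "presburger_set ({w. (\<lambda>(z :: (int ^ 'k) \<times> int, u). (fst z, u)) w \<in> S} \<inter>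
      {w. lam (snd w) = snd (fst w)})"
    by (intro presburger_set_Int presburger_set_vimage[OF S] presburger_set_eq
        affine_hom_comp[OF lam affine_hom_snd] affine_hom_comp[OF affine_hom_snd affine_hom_fst])
  then have "presburger_set V"
    unfolding V_def by (intro presburger_set_ex_vec) (simp add: case_prod_unfold Collect_conj_eq)
  from least_piecewise_quasilinear[OF this] show ?thesis
    unfolding V_iff v_defined_def v_inv_def by (simp add: Bex_def Ball_def)
qed

end
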